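(* (1) The length of each diagonal of every Diophantine quadrilateral inscribed in a circle is greater than $2$. (2) The Diophantine quadrilaterals inscribed in a circle that have a side of length $2$ are exactly those which, after a suitable labelling of the vertices in cyclic order as $A,B,C,D$, satisfy $$|AB|=a,\quad |BC|=2,\quad |CD|=2d,\quad |AD|=d,\quad |DB|=2d,\quad |AC|=a+1,$$ where $a,d$ are positive integers with $(2a+1)^2-12d^2=1$.
   Context: A quadrilateral (called "tetragon" or "rectangle" in the source) is a non-degenerate polygon in the Euclidean plane with four vertices. It is called Diophantine if the lengths of all four sides and both diagonals are natural numbers (positive integers). It is inscribed in a circle if its four vertices lie on a common circle (so in particular it is convex). *)

theory Defs
  imports "HOL-Analysis.Analysis"
begin

text \<open>
  A tetragon is given by its four vertices in cyclic order. Consecutive vertices are not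
  collinear (so the vertices are real corners and adjacent sides meet only in their common
  vertex), and opposite sides are disjoint (so the polygon does not cross itself).
\<close>

definition tetragon :: "real^2 \<Rightarrow> real^2 \<Rightarrow> real^2 \<Rightarrow> real^2 \<Rightarrow> bool" where
  "tetragon A B C D \<longleftrightarrow>
     \<not> collinear {A, B, C} \<and> \<not> collinear {B, C, D} \<and>
     \<not> collinear {C, D, A} \<and> \<not> collinear {D, A, B} \<and>
     closed_segment A B \<inter> closed_segment C D = {} \<and>
     closed_segment B C \<inter> closed_segment D A = {}"

definition diophantine_tetragon :: "real^2 \<Rightarrow> real^2 \<Rightarrow> real^2 \<Rightarrow> real^2 \<Rightarrow> bool" where
  "diophantine_tetragon A B C D \<longleftrightarrow>
     tetragon A B C D \<and>
     {dist A B, dist B C, dist C D, dist D A, dist A C, dist B D} \<subseteq> \<nat> - {0}"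

definition inscribed_in_circle :: "real^2 \<Rightarrow> real^2 \<Rightarrow> real^2 \<Rightarrow> real^2 \<Rightarrow> bool" where
  "inscribed_in_circle A B C D \<longleftrightarrow> (\<exists>M r. r > 0 \<and> {A, B, C, D} \<subseteq> sphere M r)"

text \<open>The eight ways of listing the vertices of the tetragon \<open>P Q R S\<close> in cyclic order.\<close>

definition cyclic_labellings ::
  "real^2 \<Rightarrow> real^2 \<Rightarrow> real^2 \<Rightarrow> real^2 \<Rightarrow> ((real^2) \<times> (real^2) \<times> (real^2) \<times> (real^2)) set" where
  "cyclic_labellings P Q R S =
     {(P, Q, R, S), (Q, R, S, P), (R, S, P, Q), (S, P, Q, R),
      (S, R, Q, P), (R, Q, P, S), (Q, P, S, R), (P, S, R, Q)}"

end

theory Submission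
  imports Defs
begin

text \<open>
  Write \<open>a, b, c, d\<close> for the sides \<open>AB, BC, CD, DA\<close> and \<open>e, f\<close> for the diagonals \<open>AC, BD\<close>.
  An inscribed tetragon satisfies both theorems of Ptolemy, \<open>e f = a c + b d\<close> and
  \<open>e (a b + c d) = f (d a + b c)\<close> (\<open>ptolemy_product\<close>, \<open>ptolemy_quotient\<close>). After that the
  theorem is a matter of integers: in a proper triangle with integer sides, a side of length at
  most \<open>2\<close> forces the other two sides to differ by at most \<open>1\<close>.

  A diagonal \<open>e\<close> of length \<open>1\<close> or \<open>2\<close> makes \<open>f\<close>, computed from the first theorem, too long for
  the triangles that contain it (\<open>diagonal_arith\<close>). If \<open>b = 2\<close>, then \<open>e - a\<close> and \<open>f - c\<close> lie in
  \<open>{-1, 0, 1}\<close>, which turns the first theorem into one of nine linear equations. Six of them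
  contradict a triangle inequality or positivity, the one for \<open>e = a + 1\<close>, \<open>f = c + 1\<close> leads to an
  isosceles trapezoid and fails by parity, and the remaining two are mirror images of each other
  and describe the claimed family; there the second theorem becomes the Pell equation
  (\<open>side_two_arith\<close>).

  Conversely, the lengths of the family satisfy \<open>e f = a c + b d\<close>, so that the tetragon is
  inscribed by the converse of Ptolemy's theorem (\<open>ptolemy_converse\<close>).

  Both theorems of Ptolemy are obtained from signed areas. Any four points of the plane satisfy an
  additive relation between the signed areas of their four triangles (\<open>orient_sum\<close>), and four
  points on a circle satisfy a second one that involves squared distances
  (\<open>orient_dist_relation\<close>). On a circle of radius \<open>r\<close> the area of a triangle is the product of its
  sides divided by \<open>4 r\<close> (\<open>orient_on_sphere\<close>), and since opposite sides do not cross, the four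
  signed areas have the same sign (\<open>noncrossing_chords_orient\<close>). Substituting products of sides
  for the areas gives the two theorems.
\<close>

section \<open>Signed areas\<close>

text \<open>Twice the signed area of the triangle \<open>XYZ\<close>.\<close>

definition orient :: "real^2 \<Rightarrow> real^2 \<Rightarrow> real^2 \<Rightarrow> real" where
  "orient X Y Z = (Y$1 - X$1) * (Z$2 - X$2) - (Y$2 - X$2) * (Z$1 - X$1)"

lemma orient_rotate: "orient Y Z X = orient X Y Z"
  by (simp add: orient_def algebra_simps)

text \<open>
  The affine dependence of four points of the plane; its coefficients add up to zero by
  \<open>orient_sum\<close>. With the terms of \<open>A, B\<close> on one side and those of \<open>C, D\<close> on the other, it exhibits
  the intersection point of the lines \<open>AB\<close> and \<open>CD\<close>, if they are not parallel.
\<close>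

lemma orient_relation:
  "orient B C D *\<^sub>R A - orient A C D *\<^sub>R B + orient A B D *\<^sub>R C - orient A B C *\<^sub>R D = 0"
  by (simp add: vec_eq_iff forall_2 orient_def algebra_simps)

lemma orient_sum: "orient A B C + orient A C D = orient A B D + orient B C D"
  by (simp add: orient_def algebra_simps)

section \<open>Four points on a circle\<close>

lemma dist_vec2_squared: "(dist X Y)\<^sup>2 = (X$1 - Y$1)\<^sup>2 + (X$2 - Y$2)\<^sup>2" for X Y :: "real^2"
  by (simp add: dist_vec_def L2_set_def sum_2 dist_real_def)

lemma sphere_vec2_iff:
  fixes X :: "real^2"
  assumes "r \<ge> 0"
  shows "X \<in> sphere M r \<longleftrightarrow> (X$1 - M$1)\<^sup>2 + (X$2 - M$2)\<^sup>2 = r\<^sup>2"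
proof -
  have "X \<in> sphere M r \<longleftrightarrow> (dist X M)\<^sup>2 = r\<^sup>2"
    using assms by (simp add: dist_commute)
  then show ?thesis by (simp only: dist_vec2_squared)
qed

text \<open>
  The formula \<open>4 r \<cdot> area = product of the sides\<close>, squared, with the circumcentre at the origin.
  All quantities are polynomials in \<open>R\<close> and the three inner products \<open>p, q, s\<close>; the identity
  between them is that the Gram determinant of three vectors in the plane vanishes.
\<close>

lemma circumradius_coordinates:
  fixes x1 x2 y1 y2 z1 z2 R :: real
  assumes "x1\<^sup>2 + x2\<^sup>2 = R" "y1\<^sup>2 + y2\<^sup>2 = R" "z1\<^sup>2 + z2\<^sup>2 = R"
  shows "4 * R * ((y1 - x1) * (z2 - x2) - (y2 - x2) * (z1 - x1))\<^sup>2 =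
         ((x1 - y1)\<^sup>2 + (x2 - y2)\<^sup>2) * ((y1 - z1)\<^sup>2 + (y2 - z2)\<^sup>2) * ((z1 - x1)\<^sup>2 + (z2 - x2)\<^sup>2)"
proof -
  define p q s where "p = y1 * z1 + y2 * z2" and "q = x1 * z1 + x2 * z2" and "s = x1 * y1 + x2 * y2"
  have "(x1\<^sup>2 + x2\<^sup>2) * (y1\<^sup>2 + y2\<^sup>2) * (z1\<^sup>2 + z2\<^sup>2) + 2 * p * q * s =
        (x1\<^sup>2 + x2\<^sup>2) * p\<^sup>2 + (y1\<^sup>2 + y2\<^sup>2) * q\<^sup>2 + (z1\<^sup>2 + z2\<^sup>2) * s\<^sup>2"
    unfolding p_def q_def s_def by (simp add: power2_eq_square algebra_simps)
  then have gram: "R * R * R + 2 * p * q * s = R * p\<^sup>2 + R * q\<^sup>2 + R * s\<^sup>2"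
    by (simp only: assms)
  have d: "(x1 - y1)\<^sup>2 + (x2 - y2)\<^sup>2 = 2 * (R - s)" "(y1 - z1)\<^sup>2 + (y2 - z2)\<^sup>2 = 2 * (R - p)"
    "(z1 - x1)\<^sup>2 + (z2 - x2)\<^sup>2 = 2 * (R - q)"
    using assms unfolding p_def q_def s_def by (simp_all add: power2_eq_square algebra_simps)
  have "((y1 - x1) * (z2 - x2) - (y2 - x2) * (z1 - x1))\<^sup>2 =
        ((x1 - y1)\<^sup>2 + (x2 - y2)\<^sup>2) * ((z1 - x1)\<^sup>2 + (z2 - x2)\<^sup>2) -
        ((y1 - x1) * (z1 - x1) + (y2 - x2) * (z2 - x2))\<^sup>2"
    by (simp add: power2_eq_square algebra_simps)
  also have "(y1 - x1) * (z1 - x1) + (y2 - x2) * (z2 - x2) = p - q - s + R"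
    using assms unfolding p_def q_def s_def by (simp add: power2_eq_square algebra_simps)
  finally show ?thesis
    unfolding d using gram by algebra
qed

lemma orient_on_sphere:
  assumes "r > 0" "X \<in> sphere M r" "Y \<in> sphere M r" "Z \<in> sphere M r"
  shows "2 * r * \<bar>orient X Y Z\<bar> = dist X Y * dist Y Z * dist Z X"
proof -
  have "4 * r\<^sup>2 * (orient X Y Z)\<^sup>2 = (dist X Y)\<^sup>2 * (dist Y Z)\<^sup>2 * (dist Z X)\<^sup>2"
    using circumradius_coordinates[of "X$1 - M$1" "X$2 - M$2" "r\<^sup>2" "Y$1 - M$1" "Y$2 - M$2" "Z$1 - M$1" "Z$2 - M$2"]
      assms by (simp add: sphere_vec2_iff orient_def dist_vec2_squared del: mem_sphere)
  then have "(2 * r * \<bar>orient X Y Z\<bar>)\<^sup>2 = (dist X Y * dist Y Z * dist Z X)\<^sup>2"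
    by (simp add: power_mult_distrib)
  then show ?thesis
    using assms(1) by (simp add: power2_eq_iff_nonneg)
qed

text \<open>
  On a circle \<open>|X - A|^2\<close> is an affine function of \<open>X\<close>, because \<open>|X - M|^2\<close> is constant. Applying it
  to the affine dependence of \<open>A, B, C, D\<close> gives this relation.
\<close>

lemma orient_dist_relation:
  assumes "r > 0" "{A, B, C, D} \<subseteq> sphere M r"
  shows "orient A B D * (dist A C)\<^sup>2 = orient A C D * (dist A B)\<^sup>2 + orient A B C * (dist A D)\<^sup>2"
proof -
  have *: "(A$1 - M$1)\<^sup>2 + (A$2 - M$2)\<^sup>2 = r\<^sup>2" "(B$1 - M$1)\<^sup>2 + (B$2 - M$2)\<^sup>2 = r\<^sup>2"
     "(C$1 - M$1)\<^sup>2 + (C$2 - M$2)\<^sup>2 = r\<^sup>2" "(D$1 - M$1)\<^sup>2 + (D$2 - M$2)\<^sup>2 = r\<^sup>2"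
    using assms by (simp_all add: sphere_vec2_iff del: mem_sphere)
  show ?thesis
    unfolding dist_vec2_squared orient_def using * by algebra
qed

text \<open>
  The power of a point on the line \<open>CD\<close>. The sign of \<open>t (1 - t)\<close> tells whether the point lies
  between \<open>C\<close> and \<open>D\<close>, so for points on a line through two points of the circle, being in the
  disc and being on the chord are the same.
\<close>

lemma dist_sphere_affine:
  fixes C D M :: "'a::real_inner"
  assumes "C \<in> sphere M r" "D \<in> sphere M r"
  shows "(dist M ((1 - t) *\<^sub>R C + t *\<^sub>R D))\<^sup>2 = r\<^sup>2 - t * (1 - t) * (dist C D)\<^sup>2"
proof -
  define u where "u = C - M"
  define v where "v = D - M"
  have r: "u \<bullet> u = r\<^sup>2" "v \<bullet> v = r\<^sup>2"
    using assms unfolding u_def v_def by (auto simp: dist_norm norm_minus_commute dot_square_norm)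
  have 1: "dist M ((1 - t) *\<^sub>R C + t *\<^sub>R D) = norm ((1 - t) *\<^sub>R u + t *\<^sub>R v)"
    unfolding dist_norm u_def v_def by (subst norm_minus_commute) (simp add: algebra_simps)
  have 2: "dist C D = norm (u - v)"
    by (simp add: dist_norm u_def v_def)
  show ?thesis
    unfolding 1 2 power2_norm_eq_inner
    using r by (simp add: inner_simps inner_commute[of v u]) (simp add: algebra_simps power2_eq_square)
qed

text \<open>
  If \<open>C\<close> and \<open>D\<close> are on different sides of the line \<open>AB\<close>, then the segment \<open>CD\<close> meets this line
  in a point \<open>X\<close>. As a point of the segment \<open>CD\<close> it lies in the disc, hence on the chord \<open>AB\<close>.
\<close>

lemma noncrossing_chords_orient:
  assumes "r > 0" "{A, B, C, D} \<subseteq> sphere M r"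
    and "orient A B C \<noteq> 0" "orient A B D \<noteq> 0"
    and "closed_segment A B \<inter> closed_segment C D = {}"
  shows "orient A B C * orient A B D > 0"
proof (rule ccontr)
  assume "\<not> ?thesis"
  then have neg: "orient A B C * orient A B D < 0"
    using assms(3,4) by (simp add: not_less less_le)
  define p q where "p = orient A B C" and "q = orient A B D"
  define u v where "u = orient A C D" and "v = orient B C D"
  have k: "q - p \<noteq> 0" using neg unfolding p_def q_def
    by (metis eq_iff_diff_eq_0 mult_less_0_iff order_less_asym)
  have sum: "u - v = q - p" using orient_sum[of A B C D] by (simp add: p_def q_def u_def v_def)
  \<comment> \<open>the parameters on \<open>CD\<close> and \<open>AB\<close> of the intersection point given by \<open>orient_relation\<close>\<close>
  define t where "t = - p / (q - p)"
  define s where "s = u / (q - p)"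
  define X where "X = (1 - t) *\<^sub>R C + t *\<^sub>R D"
  have t1: "1 - t = q / (q - p)" using k by (simp add: t_def field_simps)
  have s1: "1 - s = - v / (q - p)" using k sum by (simp add: s_def field_simps)
  have "q *\<^sub>R C - p *\<^sub>R D = u *\<^sub>R B - v *\<^sub>R A"
    using orient_relation[of B C D A] by (simp add: p_def q_def u_def v_def algebra_simps)
  then have "(1 / (q - p)) *\<^sub>R (q *\<^sub>R C - p *\<^sub>R D) = (1 / (q - p)) *\<^sub>R (u *\<^sub>R B - v *\<^sub>R A)" by simp
  then have X2: "X = (1 - s) *\<^sub>R A + s *\<^sub>R B"
    unfolding X_def t1 s1 unfolding t_def s_def by (simp add: algebra_simps)
  have "t * (1 - t) = - (p * q) / (q - p)\<^sup>2"
    unfolding t1 by (simp add: t_def power2_eq_square)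
  then have t_pos: "t * (1 - t) > 0"
    using neg k by (simp add: p_def q_def divide_neg_pos)
  have CD: "C \<noteq> D" using neg by (auto simp: not_less[symmetric])
  have "s * (1 - s) * (dist A B)\<^sup>2 = t * (1 - t) * (dist C D)\<^sup>2"
    using dist_sphere_affine[of A M r B s] dist_sphere_affine[of C M r D t] assms(2)
    by (simp flip: X2 X_def)
  also have "\<dots> > 0" using t_pos CD by simp
  finally have s_pos: "s * (1 - s) > 0" by (simp add: zero_less_mult_iff)
  have "X \<in> closed_segment C D" "X \<in> closed_segment A B"
    unfolding in_segment
    using X_def X2 t_pos s_pos by (auto simp: zero_less_mult_iff intro: less_imp_le)
  then show False using assms(5) by blast
qed

section \<open>Ptolemy's theorems and the converse\<close>

text \<open>
  The three applications of \<open>noncrossing_chords_orient\<close> show that the four signed areas share one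
  sign \<open>\<sigma>\<close>. After cancelling \<open>\<sigma>\<close>, each area is replaced by the product of the sides of its
  triangle.
\<close>

lemma ptolemy:
  fixes A B C D :: "real^2"
  assumes "r > 0" "{A, B, C, D} \<subseteq> sphere M r" "distinct [A, B, C, D]"
    and "closed_segment A B \<inter> closed_segment C D = {}"
    and "closed_segment B C \<inter> closed_segment D A = {}"
  shows ptolemy_product: "dist A C * dist B D = dist A B * dist C D + dist B C * dist D A"
    and ptolemy_quotient: "dist A C * (dist A B * dist B C + dist C D * dist D A) =
           dist B D * (dist D A * dist A B + dist B C * dist C D)"
proof -
  have o: "2 * r * \<bar>orient A B C\<bar> = dist A B * dist B C * dist A C"
    "2 * r * \<bar>orient A B D\<bar> = dist A B * dist B D * dist D A"
    "2 * r * \<bar>orient A C D\<bar> = dist A C * dist C D * dist D A"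
    "2 * r * \<bar>orient B C D\<bar> = dist B C * dist C D * dist B D"
    using orient_on_sphere[of r A M B C] orient_on_sphere[of r A M B D]
      orient_on_sphere[of r A M C D] orient_on_sphere[of r B M C D] assms(1,2)
    by (simp_all add: dist_commute)
  have pos: "dist A B > 0" "dist B C > 0" "dist C D > 0" "dist D A > 0" "dist A C > 0" "dist B D > 0"
    using assms(3) by auto
  have nz: "orient A B C \<noteq> 0" "orient A B D \<noteq> 0" "orient A C D \<noteq> 0" "orient B C D \<noteq> 0"
    using o pos assms(3) by auto
  have 1: "orient A B C * orient A B D > 0"
    using noncrossing_chords_orient[OF assms(1,2)] nz assms(4) by blast
  have 2: "orient A C D * orient B C D > 0"
    using noncrossing_chords_orient[of r C D A B M] nz assms(1,2,4)
    by (auto simp: orient_rotate[of C D A] orient_rotate[of C D B] Int_commute)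
  have 3: "orient B C D * orient A B C > 0"
    using noncrossing_chords_orient[of r B C D A M] nz assms(1,2,5)
    by (auto simp: orient_rotate[of B C A])
  obtain \<sigma> :: real where \<sigma>: "\<bar>\<sigma>\<bar> = 1"
    "orient A B C = \<sigma> * \<bar>orient A B C\<bar>" "orient A B D = \<sigma> * \<bar>orient A B D\<bar>"
    "orient A C D = \<sigma> * \<bar>orient A C D\<bar>" "orient B C D = \<sigma> * \<bar>orient B C D\<bar>"
  proof (cases "orient A B C > 0")
    case True
    then show ?thesis using that[of 1] 1 2 3 by (auto simp: zero_less_mult_iff)
  next
    case False
    then show ?thesis using that[of "-1"] 1 2 3 nz by (auto simp: zero_less_mult_iff)
  qed
  have [simp]: "\<sigma> \<noteq> 0" using \<sigma>(1) by auto
  have rel: "\<bar>orient A B D\<bar> * (dist A C)\<^sup>2 = \<bar>orient A C D\<bar> * (dist A B)\<^sup>2 + \<bar>orient A B C\<bar> * (dist D A)\<^sup>2"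
  proof -
    have "\<sigma> * (\<bar>orient A B D\<bar> * (dist A C)\<^sup>2) = \<sigma> * (\<bar>orient A C D\<bar> * (dist A B)\<^sup>2 + \<bar>orient A B C\<bar> * (dist D A)\<^sup>2)"
      using orient_dist_relation[OF assms(1,2)] \<sigma>
      by (metis (no_types, lifting) dist_commute distrib_left mult.assoc)
    then show ?thesis by simp
  qed
  have sum: "\<bar>orient A B C\<bar> + \<bar>orient A C D\<bar> = \<bar>orient A B D\<bar> + \<bar>orient B C D\<bar>"
  proof -
    have "\<sigma> * (\<bar>orient A B C\<bar> + \<bar>orient A C D\<bar>) = \<sigma> * (\<bar>orient A B D\<bar> + \<bar>orient B C D\<bar>)"
      using orient_sum[of A B C D] \<sigma> by (simp add: distrib_left)
    then show ?thesis by simp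
  qed
  have "(dist A B * dist D A * dist A C) * (dist A C * dist B D) =
        (dist A B * dist D A * dist A C) * (dist A B * dist C D + dist B C * dist D A)"
    using rel[THEN arg_cong[of _ _ "\<lambda>x. 2 * r * x"]] o by (simp add: distrib_left) algebra
  then show "dist A C * dist B D = dist A B * dist C D + dist B C * dist D A"
    using pos by simp
  show "dist A C * (dist A B * dist B C + dist C D * dist D A) =
           dist B D * (dist D A * dist A B + dist B C * dist C D)"
    using sum[THEN arg_cong[of _ _ "\<lambda>x. 2 * r * x"]] o by (simp add: distrib_left algebra_simps)
qed

lemma dist_inversion:
  fixes x y :: "'a::real_inner"
  assumes "x \<noteq> 0" "y \<noteq> 0"
  shows "dist (x /\<^sub>R (norm x)\<^sup>2) (y /\<^sub>R (norm y)\<^sup>2) = dist x y / (norm x * norm y)"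
proof -
  have "(dist (x /\<^sub>R (norm x)\<^sup>2) (y /\<^sub>R (norm y)\<^sup>2))\<^sup>2 = (dist x y / (norm x * norm y))\<^sup>2"
    using assms unfolding dist_norm power_divide power_mult_distrib power2_norm_eq_inner
    by (simp add: inner_simps inner_commute[of y x] field_simps)
  then show ?thesis by (simp add: power2_eq_iff_nonneg)
qed

text \<open>
  The point \<open>A + M\<close> is the circumcentre: the two equations are \<open>|M - (B - A)| = |M|\<close> and
  \<open>|M - (C - A)| = |M|\<close>, squared and simplified. They form a linear system whose determinant \<open>k\<close>
  vanishes only for collinear points; \<open>M\<close> is its solution by Cramer's rule.
\<close>

lemma circumcenter_exists:
  fixes A B C :: "real^2"
  assumes "\<not> collinear {A, B, C}"
  obtains M where "M \<bullet> (B - A) = (norm (B - A))\<^sup>2 / 2" "M \<bullet> (C - A) = (norm (C - A))\<^sup>2 / 2"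
proof -
  define b1 b2 c1 c2 where "b1 = (B - A)$1" "b2 = (B - A)$2" "c1 = (C - A)$1" "c2 = (C - A)$2"
  note defs = this
  define k where "k = b1 * c2 - b2 * c1"
  define p q where "p = (b1\<^sup>2 + b2\<^sup>2) / 2" and "q = (c1\<^sup>2 + c2\<^sup>2) / 2"
  have k: "k \<noteq> 0"
  proof
    assume "k = 0"
    have "collinear {0, B - A, C - A}"
      unfolding collinear_lemma
    proof (cases "B - A = 0")
      case False
      then have "b1\<^sup>2 + b2\<^sup>2 \<noteq> 0"
        by (auto simp: defs vec_eq_iff forall_2 sum_power2_eq_zero_iff)
      then have "C - A = ((b1 * c1 + b2 * c2) / (b1\<^sup>2 + b2\<^sup>2)) *\<^sub>R (B - A)"
        using \<open>k = 0\<close> unfolding k_def vec_eq_iff forall_2 vector_scaleR_component defs[symmetric]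
        by (auto simp: field_simps; algebra)
      then show "B - A = 0 \<or> C - A = 0 \<or> (\<exists>c. C - A = c *\<^sub>R (B - A))" by blast
    qed simp
    then show False using assms collinear_3[of B A C] by (simp add: insert_commute)
  qed
  define M :: "real^2" where "M = vector [(p * c2 - q * b2) / k, (q * b1 - p * c1) / k]"
  have "M \<bullet> (B - A) = p" "M \<bullet> (C - A) = q"
    unfolding inner_vec_def sum_2 M_def vector_2 inner_real_def defs[symmetric]
    using k by (simp_all flip: add_divide_distrib) (simp_all add: nonzero_divide_eq_eq k_def algebra_simps)
  moreover have "(norm (B - A))\<^sup>2 = 2 * p" "(norm (C - A))\<^sup>2 = 2 * q"
    unfolding power2_norm_eq_inner inner_vec_def sum_2 inner_real_def defs[symmetric] p_def q_def
    by (simp_all add: power2_eq_square)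
  ultimately show ?thesis using that[of M] by simp
qed

text \<open>
  Inversion at \<open>A\<close> turns the equation into \<open>|B'D'| = |B'C'| + |C'D'|\<close>, so the image of \<open>C\<close> lies on
  the line through the images of \<open>B\<close> and \<open>D\<close>. Inverting back, this line is the circle through
  \<open>A, B, D\<close>; with \<open>A\<close> as origin both are described by \<open>M \<bullet> X' = 1/2\<close>, where \<open>M\<close> is the
  centre of the circle.
\<close>

lemma ptolemy_converse:
  fixes A B C D :: "real^2"
  assumes "\<not> collinear {A, B, D}" "A \<noteq> C"
    and eq: "dist A C * dist B D = dist A B * dist C D + dist B C * dist D A"
  shows "inscribed_in_circle A B C D"
proof -
  have ne: "A \<noteq> B" "A \<noteq> D" using assms(1) by (auto simp: insert_commute)
  define J where "J X = (X - A) /\<^sub>R (norm (X - A))\<^sup>2" for X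
  have J: "dist (J X) (J Y) = dist X Y / (dist A X * dist A Y)" if "X \<noteq> A" "Y \<noteq> A" for X Y
    using dist_inversion[of "X - A" "Y - A"] that
    by (simp add: J_def dist_norm norm_minus_commute)
  have "dist (J B) (J D) = dist (J B) (J C) + dist (J C) (J D)"
    using ne assms(2) eq by (simp add: J dist_commute field_simps)
  then have "J C \<in> closed_segment (J B) (J D)"
    by (simp flip: between_mem_segment add: between)
  then obtain t where t: "J C = (1 - t) *\<^sub>R J B + t *\<^sub>R J D"
    unfolding in_segment by blast
  obtain M where "M \<bullet> (B - A) = (norm (B - A))\<^sup>2 / 2" "M \<bullet> (D - A) = (norm (D - A))\<^sup>2 / 2"
    using circumcenter_exists[OF assms(1)] by blast
  then have MJ: "M \<bullet> J B = 1 / 2" "M \<bullet> J D = 1 / 2" using ne by (simp_all add: J_def divide_simps)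
  then have MC: "M \<bullet> J C = 1 / 2"
    unfolding t inner_add_right inner_scaleR_right MJ by (simp add: field_simps)
  have "dist (A + M) X = norm M" if "X \<noteq> A" "M \<bullet> J X = 1 / 2" for X
  proof -
    have "2 * (M \<bullet> (X - A)) = (norm (X - A))\<^sup>2"
      using that by (simp add: J_def divide_simps mult.commute)
    then have "(norm (M - (X - A)))\<^sup>2 = (norm M)\<^sup>2"
      by (simp add: power2_norm_eq_inner inner_simps inner_commute algebra_simps)
    then show ?thesis by (simp add: power2_eq_iff_nonneg dist_norm algebra_simps)
  qed
  then have "{A, B, C, D} \<subseteq> sphere (A + M) (norm M)"
    using MJ MC ne assms(2) by (auto simp: dist_norm)
  moreover have "norm M > 0" using MC by auto
  ultimately show ?thesis unfolding inscribed_in_circle_def by blast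
qed

section \<open>Integer side lengths\<close>

lemma collinear_if_dist_add:
  fixes X Y Z :: "'a::euclidean_space"
  assumes "dist X Y + dist Y Z = dist X Z"
  shows "collinear {X, Y, Z}"
proof -
  have "between (X, Z) Y" using assms by (simp only: between)
  then show ?thesis using between_imp_collinear collinear_def by (metis insert_commute)
qed

lemma triangle_strict:
  fixes X Y Z :: "'a::euclidean_space"
  assumes "\<not> collinear {X, Y, Z}"
  shows "dist X Z < dist X Y + dist Y Z"
  using assms collinear_if_dist_add[of X Y Z] dist_triangle[of X Z Y] by force

text \<open>
  If \<open>e = 1\<close>, both triangles over this diagonal are isosceles and \<open>f = 2 a c \<ge> a + c\<close>, which is too
  long. If \<open>e = 2\<close>, then \<open>a c + b d \<ge> a + b + c + d - 2\<close>, while the triangle inequalities for \<open>f\<close>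
  give the opposite estimate for \<open>2 f\<close>; so all these estimates are equalities, which is impossible
  for proper triangles.
\<close>

lemma diagonal_arith:
  fixes a b c d e f :: int
  assumes "a > 0" "b > 0" "c > 0" "d > 0" "e > 0"
    and "e < a + b" "a < b + e" "b < a + e" "e < c + d" "c < d + e" "d < c + e"
    and "f < a + d" "f < b + c" and pt: "e * f = a * c + b * d"
  shows "e > 2"
proof (rule ccontr)
  assume "\<not> ?thesis"
  then consider "e = 1" | "e = 2" using \<open>e > 0\<close> by linarith
  then show False
  proof cases
    case 1
    then have "b = a" "d = c" using assms by linarith+
    then have "f = 2 * (a * c)" "f < a + c" using pt 1 \<open>f < a + d\<close> by simp_all
    moreover have "a \<le> a * c" "c \<le> a * c"
      using assms by simp_all
    ultimately show False by linarith
  next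
    case 2
    have ac: "(a - 1) * (c - 1) \<ge> 0" and bd: "(b - 1) * (d - 1) \<ge> 0" using assms by simp_all
    have "2 * f = a * c + b * d" "2 * f \<le> a + b + c + d - 2"
      using pt 2 \<open>f < a + d\<close> \<open>f < b + c\<close> by simp_all
    moreover have "a * c + b * d = (a - 1) * (c - 1) + (b - 1) * (d - 1) + (a + b + c + d - 2)"
      by (simp add: algebra_simps)
    ultimately have z: "(a - 1) * (c - 1) = 0" "(b - 1) * (d - 1) = 0" and
       f: "2 * f = a + b + c + d - 2" "f = a + d - 1" "f = b + c - 1"
      using ac bd assms by linarith+
    from z have "a = 1 \<or> c = 1" "b = 1 \<or> d = 1" by auto
    then show False
      using f \<open>a > 0\<close> \<open>c > 0\<close> \<open>e < a + b\<close> \<open>e < c + d\<close> 2 by (elim disjE) linarith+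
  qed
qed

text \<open>
  Here \<open>b = 2\<close>. The two alternatives of the conclusion are exchanged by the reflection that swaps
  \<open>a\<close> with \<open>c\<close> and \<open>e\<close> with \<open>f\<close>.
\<close>

lemma side_two_arith:
  fixes a c d e f :: int
  assumes pos: "a > 0" "c > 0" "d > 0"
    and "e < a + 2" "a < e + 2" "f < c + 2" "c < f + 2" "a < d + f" "c < d + e"
    and p1: "e * f = a * c + 2 * d" and p2: "e * (2 * a + c * d) = f * (a * d + 2 * c)"
  shows "(c = 2 * d \<and> e = a + 1 \<and> f = c \<and> (2 * a + 1)\<^sup>2 - 12 * d\<^sup>2 = 1) \<or>
         (a = 2 * d \<and> f = c + 1 \<and> e = a \<and> (2 * c + 1)\<^sup>2 - 12 * d\<^sup>2 = 1)"
proof -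
  consider "e = a - 1" | "e = a" | "e = a + 1" using assms by linarith
  then show ?thesis
  proof cases
    case 1
    consider "f = c - 1" | "f = c" | "f = c + 1" using assms by linarith
    then show ?thesis using p1 1 assms by cases (simp_all add: algebra_simps)
  next
    case 2
    consider "f = c - 1" | "f = c" | "f = c + 1" using assms by linarith
    then show ?thesis
    proof cases
      case 3
      then have a: "a = 2 * d" using p1 2 by (simp add: algebra_simps)
      have "d * ((2 * c + 1)\<^sup>2 - 12 * d\<^sup>2 - 1) = 0"
        using p2 unfolding 2 3 a by algebra
      then show ?thesis using a 2 3 pos by simp
    next
      case 1
      have "a * f = a * c - a" unfolding 1 by (simp add: algebra_simps)
      then show ?thesis using p1 2 pos by simp
    qed (use p1 2 pos in simp)
  next
    case 3
    consider "f = c - 1" | "f = c" | "f = c + 1" using assms by linarith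
    then show ?thesis
    proof cases
      case 1
      have "e * f = a * c - a + c - 1" unfolding 1 3 by (simp add: algebra_simps)
      then show ?thesis using p1 3 pos \<open>c < d + e\<close> by linarith
    next
      case 2
      then have c: "c = 2 * d" using p1 3 by (simp add: algebra_simps)
      have "d * ((2 * a + 1)\<^sup>2 - 12 * d\<^sup>2 - 1) = 0"
        using p2 unfolding 2 3 c by algebra
      then show ?thesis using c 2 3 pos by simp
    next
      case f: 3
      have d: "2 * d = a + c + 1" using p1 3 f by (simp add: algebra_simps)
      have "(a - c) * (2 * (a + c + 1) - d) = 0"
        using p2 unfolding 3 f by algebra
      then have "a = c" using d pos by simp
      \<comment> \<open>an isosceles trapezoid with \<open>2 d = 2 a + 1\<close>\<close>
      then show ?thesis using d by presburger
    qed
  qed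
qed

section \<open>Inscribed Diophantine tetragons\<close>

lemma cyclic_labellings_invariant:
  assumes "(A, B, C, D) \<in> cyclic_labellings P Q R S"
  shows "tetragon A B C D \<longleftrightarrow> tetragon P Q R S"
    and "diophantine_tetragon A B C D \<longleftrightarrow> diophantine_tetragon P Q R S"
    and "inscribed_in_circle A B C D \<longleftrightarrow> inscribed_in_circle P Q R S"
    and "{dist A B, dist B C, dist C D, dist D A} = {dist P Q, dist Q R, dist R S, dist S P}"
proof -
  show t: "tetragon A B C D \<longleftrightarrow> tetragon P Q R S"
    using assms unfolding cyclic_labellings_def tetragon_def
    by (elim insertE emptyE; simp add: closed_segment_commute insert_commute Int_commute; blast)
  have d: "{dist A B, dist B C, dist C D, dist D A, dist A C, dist B D} =
        {dist P Q, dist Q R, dist R S, dist S P, dist P R, dist Q S}"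
    using assms unfolding cyclic_labellings_def
    by (elim insertE emptyE; simp add: dist_commute; blast)
  show "diophantine_tetragon A B C D \<longleftrightarrow> diophantine_tetragon P Q R S"
    unfolding diophantine_tetragon_def t d ..
  have "{A, B, C, D} = {P, Q, R, S}"
    using assms unfolding cyclic_labellings_def by (elim insertE emptyE; simp; blast)
  then show "inscribed_in_circle A B C D \<longleftrightarrow> inscribed_in_circle P Q R S"
    unfolding inscribed_in_circle_def by simp
  show "{dist A B, dist B C, dist C D, dist D A} = {dist P Q, dist Q R, dist R S, dist S P}"
    using assms unfolding cyclic_labellings_def
    by (elim insertE emptyE; simp add: dist_commute; blast)
qed

text \<open>
  The passage from geometry to integers: strictness of the triangle inequalities expresses that no
  three consecutive vertices are collinear, and Ptolemy's theorems that the tetragon is inscribed.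
\<close>

lemma diophantine_inscribed_lengths:
  assumes "diophantine_tetragon A B C D" "inscribed_in_circle A B C D"
  obtains a b c d e f :: int where
    "dist A B = of_int a" "dist B C = of_int b" "dist C D = of_int c"
    "dist D A = of_int d" "dist A C = of_int e" "dist B D = of_int f"
    "a > 0" "b > 0" "c > 0" "d > 0" "e > 0" "f > 0"
    "e < a + b" "a < b + e" "b < a + e" "e < c + d" "c < d + e" "d < c + e"
    "f < a + d" "a < d + f" "d < a + f" "f < b + c" "b < c + f" "c < b + f"
    "e * f = a * c + b * d" "e * (a * b + c * d) = f * (d * a + b * c)"
proof -
  have t: "tetragon A B C D" and N: "dist A B \<in> \<nat> - {0}" "dist B C \<in> \<nat> - {0}" "dist C D \<in> \<nat> - {0}"
     "dist D A \<in> \<nat> - {0}" "dist A C \<in> \<nat> - {0}" "dist B D \<in> \<nat> - {0}"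
    using assms(1) by (auto simp: diophantine_tetragon_def)
  have ex: "\<exists>n::int. n > 0 \<and> dist X Y = of_int n" if "dist X Y \<in> \<nat> - {0}" for X Y :: "real^2"
    using that by (auto elim!: Nats_cases) (metis of_int_of_nat_eq of_nat_0_less_iff dist_pos_lt)
  obtain a b c d e f :: int where L: "dist A B = of_int a" "dist B C = of_int b" "dist C D = of_int c"
    "dist D A = of_int d" "dist A C = of_int e" "dist B D = of_int f"
    and pos: "a > 0" "b > 0" "c > 0" "d > 0" "e > 0" "f > 0"
    using N[THEN ex] by blast
  have dc: "dist B A = of_int a" "dist C B = of_int b" "dist D C = of_int c"
    "dist A D = of_int d" "dist C A = of_int e" "dist D B = of_int f"
    using L by (simp_all add: dist_commute)
  have nc: "\<not> collinear {A, B, C}" "\<not> collinear {B, C, A}" "\<not> collinear {B, A, C}"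
     "\<not> collinear {C, D, A}" "\<not> collinear {D, A, C}" "\<not> collinear {D, C, A}"
     "\<not> collinear {B, A, D}" "\<not> collinear {A, D, B}" "\<not> collinear {A, B, D}"
     "\<not> collinear {B, C, D}" "\<not> collinear {C, D, B}" "\<not> collinear {C, B, D}"
    using t unfolding tetragon_def by (simp_all add: insert_commute)
  note tri = nc[THEN triangle_strict, unfolded L dc, folded of_int_add, unfolded of_int_less_iff]
  obtain M r where r: "r > 0" "{A, B, C, D} \<subseteq> sphere M r"
    using assms(2) unfolding inscribed_in_circle_def by blast
  have dis: "distinct [A, B, C, D]" using L pos by auto
  have seg: "closed_segment A B \<inter> closed_segment C D = {}" "closed_segment B C \<inter> closed_segment D A = {}"
    using t unfolding tetragon_def by auto
  note pt = ptolemy[OF r dis seg, unfolded L, folded of_int_mult of_int_add, folded of_int_mult,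
      unfolded of_int_eq_iff]
  show thesis
    by (rule that[OF L pos tri pt])
qed

lemma diophantine_inscribed_diagonal:
  assumes "diophantine_tetragon A B C D" "inscribed_in_circle A B C D"
  shows "dist A C > 2"
  using assms
proof (rule diophantine_inscribed_lengths)
  fix a b c d e f :: int
  assume e: "dist A C = of_int e"
  assume "a > 0" "b > 0" "c > 0" "d > 0" "e > 0" "f > 0"
    "e < a + b" "a < b + e" "b < a + e" "e < c + d" "c < d + e" "d < c + e"
    "f < a + d" "f < b + c" "e * f = a * c + b * d"
  then have "e > 2" by (intro diagonal_arith[of a b c d e f])
  then show ?thesis using e by simp
qed

definition pell_tetragon :: "real^2 \<Rightarrow> real^2 \<Rightarrow> real^2 \<Rightarrow> real^2 \<Rightarrow> bool" where
  "pell_tetragon A B C D \<longleftrightarrow> (\<exists>a d :: nat. a > 0 \<and> d > 0 \<and>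
     (2 * int a + 1)\<^sup>2 - 12 * (int d)\<^sup>2 = 1 \<and>
     dist A B = real a \<and> dist B C = 2 \<and> dist C D = 2 * real d \<and>
     dist A D = real d \<and> dist D B = 2 * real d \<and> dist A C = real a + 1)"

lemma pell_tetragonI:
  fixes a d :: int
  assumes "a > 0" "d > 0" "(2 * a + 1)\<^sup>2 - 12 * d\<^sup>2 = 1"
    "dist A B = of_int a" "dist B C = 2" "dist C D = of_int (2 * d)" "dist A D = of_int d"
    "dist D B = of_int (2 * d)" "dist A C = of_int (a + 1)"
  shows "pell_tetragon A B C D"
  unfolding pell_tetragon_def
  using assms by (intro exI[of _ "nat a"] exI[of _ "nat d"]) simp

text \<open>
  The second alternative is the mirror image, which keeps \<open>BC\<close> in its place.
\<close>

lemma diophantine_inscribed_side_two: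
  assumes "diophantine_tetragon A B C D" "inscribed_in_circle A B C D" "dist B C = 2"
  shows "pell_tetragon A B C D \<or> pell_tetragon D C B A"
  using assms(1,2)
proof (rule diophantine_inscribed_lengths)
  fix a b c d e f :: int
  assume L: "dist A B = of_int a" "dist B C = of_int b" "dist C D = of_int c"
    "dist D A = of_int d" "dist A C = of_int e" "dist B D = of_int f"
  assume pos: "a > 0" "c > 0" "d > 0"
    and *: "e < a + b" "a < b + e" "f < b + c" "c < b + f" "a < d + f" "c < d + e"
    "e * f = a * c + b * d" "e * (a * b + c * d) = f * (d * a + b * c)"
  have b: "b = 2" using L(2) assms(3) by simp
  have "(c = 2 * d \<and> e = a + 1 \<and> f = c \<and> (2 * a + 1)\<^sup>2 - 12 * d\<^sup>2 = 1) \<or>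
         (a = 2 * d \<and> f = c + 1 \<and> e = a \<and> (2 * c + 1)\<^sup>2 - 12 * d\<^sup>2 = 1)"
    using pos * b by (intro side_two_arith) (simp_all add: mult.commute add.commute)
  then show ?thesis
    using L pos b pell_tetragonI[of a d A B C D] pell_tetragonI[of c d D C B A]
    by (auto simp: dist_commute)
qed

lemma pell_tetragon_inscribed:
  assumes "tetragon A B C D" "pell_tetragon A B C D"
  shows "inscribed_in_circle A B C D \<and> diophantine_tetragon A B C D \<and> dist B C = 2"
proof -
  obtain a d :: nat where ad: "a > 0" "d > 0" "dist A B = real a" "dist B C = 2" "dist C D = 2 * real d"
    "dist A D = real d" "dist D B = 2 * real d" "dist A C = real a + 1"
    using assms(2) unfolding pell_tetragon_def by blast
  then have L: "dist A B = of_nat a" "dist B C = of_nat 2" "dist C D = of_nat (2 * d)"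
    "dist D A = of_nat d" "dist B D = of_nat (2 * d)" "dist A C = of_nat (a + 1)"
    by (simp_all add: dist_commute)
  have "diophantine_tetragon A B C D"
    unfolding diophantine_tetragon_def L using assms(1) ad(1,2)
    by (auto simp del: of_nat_add of_nat_mult of_nat_numeral)
  moreover have "\<not> collinear {A, B, D}"
    using assms(1) unfolding tetragon_def by (simp add: insert_commute)
  then have "inscribed_in_circle A B C D"
    by (rule ptolemy_converse) (use L in \<open>auto simp: algebra_simps\<close>)
  ultimately show ?thesis using ad by blast
qed

theorem mainTheorem6:
  shows
    "(\<forall>P Q R S. diophantine_tetragon P Q R S \<and> inscribed_in_circle P Q R S \<longrightarrow>
        dist P R > 2 \<and> dist Q S > 2) \<and>
     (\<forall>P Q R S. tetragon P Q R S \<longrightarrow>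
        (diophantine_tetragon P Q R S \<and> inscribed_in_circle P Q R S \<and>
           2 \<in> {dist P Q, dist Q R, dist R S, dist S P}
         \<longleftrightarrow>
         (\<exists>A B C D. (A, B, C, D) \<in> cyclic_labellings P Q R S \<and>
            (\<exists>a d :: nat. a > 0 \<and> d > 0 \<and>
               (2 * int a + 1)\<^sup>2 - 12 * (int d)\<^sup>2 = 1 \<and>
               dist A B = real a \<and> dist B C = 2 \<and> dist C D = 2 * real d \<and>
               dist A D = real d \<and> dist D B = 2 * real d \<and> dist A C = real a + 1))))"
proof -
  have 1: "dist P R > 2 \<and> dist Q S > 2"
    if "diophantine_tetragon P Q R S" "inscribed_in_circle P Q R S" for P Q R S
  proof -
    have "(Q, R, S, P) \<in> cyclic_labellings P Q R S" by (simp add: cyclic_labellings_def)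
    note inv = cyclic_labellings_invariant[OF this]
    show ?thesis
      using diophantine_inscribed_diagonal[of P Q R S] diophantine_inscribed_diagonal[of Q R S P]
        that inv by blast
  qed
  have 2: "(diophantine_tetragon P Q R S \<and> inscribed_in_circle P Q R S \<and>
           2 \<in> {dist P Q, dist Q R, dist R S, dist S P}) \<longleftrightarrow>
         (\<exists>A B C D. (A, B, C, D) \<in> cyclic_labellings P Q R S \<and> pell_tetragon A B C D)" (is "?L \<longleftrightarrow> ?R")
    if t: "tetragon P Q R S" for P Q R S
  proof
    assume L: ?L
    then obtain A B C D where lab: "(A, B, C, D) \<in> cyclic_labellings P Q R S"
        "(D, C, B, A) \<in> cyclic_labellings P Q R S" and "dist B C = 2"
      unfolding cyclic_labellings_def by (auto simp: dist_commute)
    then have "pell_tetragon A B C D \<or> pell_tetragon D C B A"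
      using L diophantine_inscribed_side_two cyclic_labellings_invariant[OF lab(1)] by blast
    then show ?R using lab by blast
  next
    assume ?R
    then obtain A B C D where lab: "(A, B, C, D) \<in> cyclic_labellings P Q R S" and "pell_tetragon A B C D"
      by blast
    note inv = cyclic_labellings_invariant[OF lab]
    have "inscribed_in_circle A B C D \<and> diophantine_tetragon A B C D \<and> dist B C = 2"
      using pell_tetragon_inscribed inv(1) t \<open>pell_tetragon A B C D\<close> by blast
    then show ?L using inv(2,3) inv(4)[symmetric] by simp
  qed
  show ?thesis
    unfolding pell_tetragon_def[symmetric]
  proof (intro conjI[OF _ allI[OF allI[OF allI[OF allI[OF impI]]]]])
    show "\<forall>P Q R S. diophantine_tetragon P Q R S \<and> inscribed_in_circle P Q R S \<longrightarrow>
        dist P R > 2 \<and> dist Q S > 2"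
      using 1 by blast
  qed (rule 2)
qed

end
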